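(* Let $0<d\le 41/100$ and $W=(2d)^{-1}\mathbf 1_{[1-d,1+d]}$, and let $m_k=\int_0^\infty t^kW(t)\,dt$ for $k=0,1,2,\dots$, so that $m_0=m_1=1$. There is no Borel probability measure $\nu$ on $[1,\infty)$ such that for every integer $k\ge1$, $$\int t^k\,d\nu(t)\ \ge\ m_k\qquad\text{and}\qquad\int t^{k-1}\,d\nu(t)\ \le\ m_k.$$
   Context: $\mathbf 1_{[1-d,1+d]}$ denotes the indicator function of the interval $[1-d,1+d]$. *)

theory Defs
  imports "HOL-Probability.Probability"
begin

definition W :: "real \<Rightarrow> real \<Rightarrow> real" where
  "W d t = inverse (2 * d) * indicator {1 - d..1 + d} t"

definition m :: "real \<Rightarrow> nat \<Rightarrow> real" where
  "m d k = (LINT t:{0..}|lborel. t ^ k * W d t)"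

end

theory Submission
  imports Defs
begin

text \<open>
  The bounds on all moments confine \<open>\<nu>\<close> to \<open>[1, 1 + d]\<close>. There \<open>t ^ 7\<close> lies below its
  chord, so the seventh moment is at most \<open>1 + (M - 1) * ((1 + d) ^ 7 - 1) / d\<close>, where
  \<open>M \<le> m d 2 = 1 + d\<^sup>2 / 3\<close> is the first moment. For \<open>d \<le> 41 / 100\<close> this is smaller than
  \<open>m d 7 = 1 + 7 * d\<^sup>2 + 7 * d ^ 4 + d ^ 6\<close>.
\<close>

lemma m_eq:
  assumes "0 < d" "d \<le> 1"
  shows "m d k = ((1 + d) ^ Suc k - (1 - d) ^ Suc k) / (2 * d * real (Suc k))"
proof -
  have "m d k = (LBINT t. inverse (2 * d) * (t ^ k * indicator {1 - d..1 + d} t))"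
    unfolding m_def set_lebesgue_integral_def
    using assms by (intro Bochner_Integration.integral_cong) (auto simp: W_def indicator_def)
  also have "\<dots> = inverse (2 * d) * (LBINT t. t ^ k * indicator {1 - d..1 + d} t)"
    by simp
  also have "\<dots> = inverse (2 * d) * (((1 + d) ^ Suc k - (1 - d) ^ Suc k) / real (Suc k))"
    using assms by (subst integral_power) auto
  finally show ?thesis
    by (simp add: divide_simps)
qed

text \<open>Crude on purpose: only the growth rate \<open>1 + d\<close> of the moments matters,
  since it becomes the bound for the support of \<open>\<nu>\<close>.\<close>

lemma m_le_power:
  assumes "0 < d" "d \<le> 1"
  shows "m d k \<le> (1 + d) ^ Suc k / (2 * d)"
proof -
  have "m d k \<le> (1 + d) ^ Suc k / (2 * d * real (Suc k))"
    unfolding m_eq[OF assms] using assms by (intro divide_right_mono) auto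
  also have "\<dots> \<le> (1 + d) ^ Suc k / (2 * d)"
    using assms by (intro divide_left_mono) auto
  finally show ?thesis .
qed

text \<open>Markov's inequality for \<open>t ^ k\<close> bounds the mass of \<open>{c..}\<close> by
  \<open>C * (b / c) ^ k\<close>, which tends to 0 as \<open>k\<close> grows whenever
  \<open>c > b\<close>.\<close>

lemma AE_le_of_moment_bounds:
  fixes \<nu> :: "real measure" and b C :: real
  assumes "finite_measure \<nu>" and [measurable]: "(\<lambda>t. t) \<in> borel_measurable \<nu>" and "b > 0" "C \<ge> 0"
    and bound: "\<And>k. (\<integral>\<^sup>+ t. ennreal (t ^ k) \<partial>\<nu>) \<le> ennreal (C * b ^ k)"
  shows "AE t in \<nu>. t \<le> b"
proof -
  interpret finite_measure \<nu> by fact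
  have null: "AE t in \<nu>. t < c" if "c > b" for c
  proof -
    define A where "A = {t \<in> space \<nu>. c \<le> t}"
    have A[measurable]: "A \<in> sets \<nu>"
      unfolding A_def by measurable
    have le: "measure \<nu> A \<le> C * (b / c) ^ k" for k
    proof -
      have "ennreal (c ^ k * measure \<nu> A) = (\<integral>\<^sup>+ t. ennreal (c ^ k) * indicator A t \<partial>\<nu>)"
        using A \<open>b > 0\<close> \<open>c > b\<close>
        by (simp add: nn_integral_cmult_indicator emeasure_eq_measure ennreal_mult)
      \<comment> \<open>Negative \<open>t\<close> do no harm: the left integrand vanishes off
        \<open>A\<close>, and \<open>ennreal\<close> sends negative values to 0.\<close>
      also have "\<dots> \<le> (\<integral>\<^sup>+ t. ennreal (t ^ k) \<partial>\<nu>)"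
        using \<open>b > 0\<close> \<open>c > b\<close>
        by (intro nn_integral_mono) (auto simp: A_def indicator_def intro!: ennreal_leI power_mono)
      also have "\<dots> \<le> ennreal (C * b ^ k)"
        by (rule bound)
      finally have *: "ennreal (c ^ k * measure \<nu> A) \<le> ennreal (C * b ^ k)" .
      have "c ^ k * measure \<nu> A \<le> C * b ^ k"
        using * \<open>b > 0\<close> \<open>C \<ge> 0\<close> by simp
      thus ?thesis
        using \<open>b > 0\<close> \<open>c > b\<close> by (simp add: power_divide field_simps)
    qed
    have "(\<lambda>k. C * (b / c) ^ k) \<longlonglongrightarrow> C * 0"
      using \<open>b > 0\<close> \<open>c > b\<close> by (intro tendsto_mult LIMSEQ_power_zero tendsto_const) auto
    hence "measure \<nu> A \<le> C * 0"
      by (rule LIMSEQ_le_const) (use le in blast)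
    hence "A \<in> null_sets \<nu>"
      using A by (intro null_setsI) (auto simp: emeasure_eq_measure measure_le_0_iff)
    thus ?thesis
      by (rule AE_I') (auto simp: A_def)
  qed
  \<comment> \<open>Only countably many thresholds \<open>c\<close> can be combined, so take a
    sequence decreasing to \<open>b\<close>.\<close>
  have "AE t in \<nu>. \<forall>n. t < b + 1 / real (Suc n)"
    by (subst AE_all_countable) (auto intro!: null)
  thus ?thesis
  proof eventually_elim
    case (elim t)
    show "t \<le> b"
    proof (rule ccontr)
      assume "\<not> t \<le> b"
      then obtain n where "inverse (real (Suc n)) < t - b"
        using reals_Archimedean[of "t - b"] by auto
      with elim[rule_format, of n] show False
        by (simp add: inverse_eq_divide)
    qed
  qed
qed

text \<open>The slope of the secant from 1 to \<open>t\<close> is the geometric sum of the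
  \<open>t ^ i\<close>, which increases with \<open>t\<close> and so is largest at
  \<open>1 + d\<close>.\<close>

lemma power_le_chord:
  fixes t d :: real
  assumes "d > 0" "1 \<le> t" "t \<le> 1 + d"
  shows "t ^ n \<le> 1 + (t - 1) * (((1 + d) ^ n - 1) / d)"
proof -
  have eq: "x ^ n - 1 = (x - 1) * (\<Sum>i<n. x ^ i)" for x :: real
    by (rule power_diff_1_eq)
  have "t ^ n - 1 \<le> (t - 1) * (\<Sum>i<n. (1 + d) ^ i)"
    unfolding eq using assms by (intro mult_left_mono sum_mono power_mono) auto
  also have "\<dots> = (t - 1) * (((1 + d) ^ n - 1) / d)"
    using assms eq[of "1 + d"] by simp
  finally show ?thesis by simp
qed

text \<open>After cancelling the constants and the factor \<open>d^2 / 3\<close>, a polynomial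
  inequality in \<open>d\<close> remains. Its increasing side is estimated at
  \<open>d = 41 / 100\<close>.\<close>

lemma chord_less_m7:
  fixes d :: real
  assumes "0 < d" "d \<le> 41 / 100"
  shows "m d 2 * (((1 + d) ^ 7 - 1) / d) < m d 7 + (((1 + d) ^ 7 - 1) / d - 1)"
proof -
  define q where "q = 7 + 21 * d + 35 * d^2 + 35 * d^3 + 21 * d^4 + 7 * d^5 + d^6"
  have m2: "m d 2 = 1 + d^2 / 3" and m7: "m d 7 = 1 + 7 * d^2 + 7 * d^4 + d^6"
    and q: "((1 + d) ^ 7 - 1) / d = q"
    using assms by (simp_all add: m_eq q_def field_simps eval_nat_numeral)
  have pow: "d ^ k \<le> (41 / 100) ^ k" for k
    using assms by (intro power_mono) auto
  \<comment> \<open>The left side is \<open>q - 3 * (7 + 7 * d^2 + d^4) + 14\<close>. Its value at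
    \<open>41 / 100\<close> is about 13.97, so the bound on \<open>d\<close> leaves little
    slack.\<close>
  have "21 * d + 14 * d^2 + 35 * d^3 + 18 * d^4 + 7 * d^5 + d^6
      \<le> 21 * (41/100) + 14 * (41/100)^2 + 35 * (41/100)^3 + 18 * (41/100)^4 + 7 * (41/100)^5 + (41/100)^6"
    using assms by (intro add_mono mult_left_mono pow) auto
  also have "\<dots> < 14"
    by (simp add: power_divide)
  finally have "q < 3 * (7 + 7 * d^2 + d^4)"
    unfolding q_def by simp
  hence "d^2 / 3 * q < d^2 / 3 * (3 * (7 + 7 * d^2 + d^4))"
    using assms by (intro mult_strict_left_mono) auto
  also have "\<dots> = 7 * d^2 + 7 * d^4 + d^6"
    by (simp add: algebra_simps flip: power_add)
  finally show ?thesis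
    unfolding m2 m7 q by (simp add: algebra_simps)
qed

theorem proposition7p2:
  fixes d :: real
  assumes "0 < d" and "d \<le> 41 / 100"
  shows "m d 0 = 1 \<and> m d 1 = 1 \<and>
    \<not> (\<exists>\<nu> :: real measure. prob_space \<nu> \<and> sets \<nu> = sets (restrict_space borel {1..}) \<and>
        (\<forall>k::nat. k \<ge> 1 \<longrightarrow>
           (\<integral>\<^sup>+ t. ennreal (t ^ k) \<partial>\<nu>) \<ge> ennreal (m d k) \<and>
           (\<integral>\<^sup>+ t. ennreal (t ^ (k - 1)) \<partial>\<nu>) \<le> ennreal (m d k)))"
proof (intro conjI notI)
  have d1: "d \<le> 1" using assms by simp
  show "m d 0 = 1" "m d 1 = 1"
    using assms d1 by (simp_all add: m_eq field_simps power2_eq_square)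
  assume "\<exists>\<nu> :: real measure. prob_space \<nu> \<and> sets \<nu> = sets (restrict_space borel {1..}) \<and>
        (\<forall>k::nat. k \<ge> 1 \<longrightarrow>
           (\<integral>\<^sup>+ t. ennreal (t ^ k) \<partial>\<nu>) \<ge> ennreal (m d k) \<and>
           (\<integral>\<^sup>+ t. ennreal (t ^ (k - 1)) \<partial>\<nu>) \<le> ennreal (m d k))"
  then obtain \<nu> :: "real measure" where "prob_space \<nu>"
    and sets: "sets \<nu> = sets (restrict_space borel {1..})"
    and lower: "\<And>k. k \<ge> 1 \<Longrightarrow> ennreal (m d k) \<le> (\<integral>\<^sup>+ t. ennreal (t ^ k) \<partial>\<nu>)"
    and upper: "\<And>k. k \<ge> 1 \<Longrightarrow> (\<integral>\<^sup>+ t. ennreal (t ^ (k - 1)) \<partial>\<nu>) \<le> ennreal (m d k)"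
    by blast
  interpret prob_space \<nu> by fact
  have space: "space \<nu> = {1..}"
    using sets_eq_imp_space_eq[OF sets] by (simp add: space_restrict_space)
  have meas[measurable]: "(\<lambda>t. t) \<in> borel_measurable \<nu>"
    unfolding measurable_cong_sets[OF sets refl] by (intro measurable_restrict_space1) simp
  \<comment> \<open>The \<open>k\<close>-th moment is controlled by \<open>m d (Suc k)\<close>,
    whose bound has exponent \<open>k + 2\<close>; hence the factor
    \<open>(1 + d)\<^sup>2\<close>.\<close>
  have bound: "(\<integral>\<^sup>+ t. ennreal (t ^ k) \<partial>\<nu>) \<le> ennreal ((1 + d)\<^sup>2 / (2 * d) * (1 + d) ^ k)" for k
  proof -
    have "(\<integral>\<^sup>+ t. ennreal (t ^ k) \<partial>\<nu>) \<le> ennreal (m d (Suc k))"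
      using upper[of "Suc k"] by simp
    also have "\<dots> \<le> ennreal ((1 + d)\<^sup>2 / (2 * d) * (1 + d) ^ k)"
      using m_le_power[OF assms(1) d1, of "Suc k"]
      by (intro ennreal_leI) (simp add: power2_eq_square mult.assoc)
    finally show ?thesis .
  qed
  have le: "AE t in \<nu>. t \<le> 1 + d"
    by (rule AE_le_of_moment_bounds[OF finite_measure_axioms meas _ _ bound]) (use assms in auto)
  \<comment> \<open>The slope of the chord of \<open>t ^ 7\<close> over \<open>[1, 1 + d]\<close>.
    Bernoulli's inequality keeps \<open>q - 1\<close> nonnegative, so \<open>ennreal\<close> does
    not truncate it.\<close>
  define q where "q = ((1 + d) ^ 7 - 1) / d"
  have "1 + 7 * d \<le> (1 + d) ^ 7"
    using Bernoulli_inequality[of d 7] assms by simp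
  hence q: "q \<ge> 1"
    using assms by (simp add: q_def field_simps)
  \<comment> \<open>The chord bound is used as \<open>t ^ 7 + (q - 1) \<le> q * t\<close>, which
    avoids subtraction in \<open>ennreal\<close>.\<close>
  have "ennreal (m d 7 + (q - 1)) \<le> ennreal (m d 7) + ennreal (q - 1)"
    using q by (cases "m d 7 \<ge> 0") (auto simp: ennreal_neg intro!: ennreal_leI)
  also have "\<dots> \<le> (\<integral>\<^sup>+ t. ennreal (t ^ 7) \<partial>\<nu>) + ennreal (q - 1)"
    by (intro add_right_mono lower) simp
  also have "\<dots> = (\<integral>\<^sup>+ t. ennreal (t ^ 7) + ennreal (q - 1) \<partial>\<nu>)"
    by (simp add: nn_integral_add emeasure_space_1)
  also have "\<dots> \<le> (\<integral>\<^sup>+ t. ennreal q * ennreal (t ^ 1) \<partial>\<nu>)"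
  proof (intro nn_integral_mono_AE)
    show "AE t in \<nu>. ennreal (t ^ 7) + ennreal (q - 1) \<le> ennreal q * ennreal (t ^ 1)"
      using le AE_space
    proof eventually_elim
      case (elim t)
      hence t: "t \<ge> 1" by (simp add: space)
      have "t ^ 7 + (q - 1) \<le> q * t"
        using power_le_chord[of d t 7, folded q_def] assms elim t by (simp add: algebra_simps)
      thus ?case
        using q t by (simp flip: ennreal_plus ennreal_mult add: ennreal_leI)
    qed
  qed
  also have "\<dots> = ennreal q * (\<integral>\<^sup>+ t. ennreal (t ^ 1) \<partial>\<nu>)"
    by (intro nn_integral_cmult) simp
  also have "\<dots> \<le> ennreal q * ennreal (m d 2)"
    using upper[of 2] by (intro mult_left_mono) simp_all
  also have "\<dots> = ennreal (m d 2 * q)"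
    using q by (simp add: ennreal_mult' mult.commute)
  finally have "ennreal (m d 7 + (q - 1)) \<le> ennreal (m d 2 * q)" .
  \<comment> \<open>Nonnegativity of \<open>m d 2\<close> makes the right side of the
    \<open>ennreal\<close> inequality nonnegative, so that it transfers back to the reals.\<close>
  moreover have "m d 2 * q < m d 7 + (q - 1)" "m d 2 \<ge> 0"
    using chord_less_m7[OF assms] assms d1 by (auto simp: q_def m_eq intro!: divide_nonneg_pos power_mono)
  ultimately show False
    using q by (simp add: ennreal_le_iff)
qed

end
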